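(* Let $\mathcal{A}$ be a finite set of integral affinographic hyperplanes in $\mathbb{R}^n$ with integral gain graph $\Phi$, and for each coordinate $i$ let $L_i\subset\mathbb{Z}$ be a finite list. Then the number of lattice points in $L_1\times\cdots\times L_n$ not lying in any hyperplane of $\mathcal{A}$ equals $$\sum_{B\subseteq E\text{ balanced}}(-1)^{|B|}\prod_{B_k}\Big|\bigcap_{v_i\in V(B_k)}\big(L_i+\varphi(B_{v_it_k})\big)\Big|,$$ where the product is over all connected components $B_k$ of the spanning subgraph $(V,B)$, $V(B_k)$ is the vertex set of $B_k$, $t_k$ is a top vertex of $B_k$, and $L_i+g$ is the translate of $L_i$ by $g$.
   Context: An integral affinographic hyperplane is a hyperplane $x_j=x_i+a$ with $i\ne j$, $a\in\mathbb{Z}$. The integral gain graph $\Phi$ of $\mathcal{A}$ has vertex set $V=\{v_1,\dots,v_n\}$ and, for each hyperplane $x_j=x_i+a$ in $\mathcal{A}$, an edge from $v_i$ to $v_j$ with gain $a$ (gain $-a$ in the reverse direction); $E$ is its edge set and path gains are sums of edge gains. An edge set $B$ is balanced if every circle in it has gain $0$; then all paths $B_{vw}$ in $B$ from $v$ to $w$ have the same gain $\varphi(B_{vw})$. A top vertex of a component of balanced $B$ is a vertex $t$ such that no path in that component ending at $t$ has negative gain. *)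

theory Defs
  imports "HOL-Analysis.Analysis"
begin

definition affinographic :: "'n::finite \<Rightarrow> 'n \<Rightarrow> int \<Rightarrow> (real ^ 'n) set" where
  "affinographic i j a = {x. x $ j = x $ i + of_int a}"

definition integral_affinographic :: "(real ^ 'n::finite) set \<Rightarrow> bool" where
  "integral_affinographic H \<longleftrightarrow> (\<exists>i j a. i \<noteq> j \<and> H = affinographic i j a)"

text \<open>
  A dart \<open>(v, g, w)\<close> is an edge traversed from \<open>v\<close> to \<open>w\<close>, with gain \<open>g\<close> in that direction.
  An (unoriented) edge of a gain graph is the set of its two mutually reverse darts, so parallel
  edges with different gains are different edges. The vertex set is always the whole type.
\<close>

type_synonym 'v dart = "'v \<times> int \<times> 'v"
type_synonym 'v gain_edge = "'v dart set"

definition tail :: "'v dart \<Rightarrow> 'v" where "tail d = fst d"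
definition dart_gain :: "'v dart \<Rightarrow> int" where "dart_gain d = fst (snd d)"
definition head :: "'v dart \<Rightarrow> 'v" where "head d = snd (snd d)"

definition rev_dart :: "'v dart \<Rightarrow> 'v dart" where
  "rev_dart d = (head d, - dart_gain d, tail d)"

definition dart_edge :: "'v dart \<Rightarrow> 'v gain_edge" where
  "dart_edge d = {d, rev_dart d}"

definition gain_graph_edges :: "(real ^ 'n::finite) set set \<Rightarrow> 'n gain_edge set" where
  "gain_graph_edges \<A> = {dart_edge (i, a, j) | i j a. i \<noteq> j \<and> affinographic i j a \<in> \<A>}"

fun walk :: "'v gain_edge set \<Rightarrow> 'v \<Rightarrow> 'v dart list \<Rightarrow> 'v \<Rightarrow> bool" where
  "walk B v [] w \<longleftrightarrow> v = w"
| "walk B v (d # p) w \<longleftrightarrow> tail d = v \<and> d \<in> \<Union>B \<and> walk B (head d) p w"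

definition gain :: "'v dart list \<Rightarrow> int" where
  "gain p = (\<Sum>d\<leftarrow>p. dart_gain d)"

definition is_path :: "'v gain_edge set \<Rightarrow> 'v \<Rightarrow> 'v dart list \<Rightarrow> 'v \<Rightarrow> bool" where
  "is_path B v p w \<longleftrightarrow> walk B v p w \<and> distinct (v # map head p)"

text \<open>
  Distinctness of the edges only excludes traversing one edge back and forth.
\<close>
definition is_circle :: "'v gain_edge set \<Rightarrow> 'v dart list \<Rightarrow> bool" where
  "is_circle B p \<longleftrightarrow> p \<noteq> [] \<and> walk B (tail (hd p)) p (tail (hd p)) \<and>
     distinct (map tail p) \<and> distinct (map dart_edge p)"

definition balanced :: "'v gain_edge set \<Rightarrow> bool" where
  "balanced B \<longleftrightarrow> (\<forall>p. is_circle B p \<longrightarrow> gain p = 0)"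

text \<open>Only meaningful when \<open>B\<close> is balanced and contains a path from \<open>v\<close> to \<open>w\<close>.\<close>
definition path_gain :: "'v gain_edge set \<Rightarrow> 'v \<Rightarrow> 'v \<Rightarrow> int" where
  "path_gain B v w = (THE g. \<exists>p. is_path B v p w \<and> g = gain p)"

text \<open>The vertex sets of the connected components, isolated vertices included.\<close>
definition component_vertex_sets :: "'v gain_edge set \<Rightarrow> 'v set set" where
  "component_vertex_sets B = UNIV // {(v, w). \<exists>p. is_path B v p w}"

definition top_vertex :: "'v gain_edge set \<Rightarrow> 'v set \<Rightarrow> 'v \<Rightarrow> bool" where
  "top_vertex B C t \<longleftrightarrow> t \<in> C \<and> (\<forall>v\<in>C. \<forall>p. is_path B v p t \<longrightarrow> \<not> gain p < 0)"

lemmas dart_defs = tail_def head_def dart_gain_def rev_dart_def dart_edge_def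

lemma walk_append: "walk B u (p @ q) w \<longleftrightarrow> (\<exists>v. walk B u p v \<and> walk B v q w)"
  by (induction p arbitrary: u) auto

lemma walk_rev:
  assumes "B \<subseteq> range dart_edge" "walk B u p v"
  shows "walk B v (rev (map rev_dart p)) u"
  using assms(2)
proof (induction p arbitrary: u)
  case (Cons d p)
  then have "d \<in> \<Union>B" by simp
  then obtain e c where e: "e \<in> B" "d \<in> e" "e = dart_edge c" using assms(1) by blast
  then have "rev_dart d \<in> e" by (auto simp: dart_defs)
  then have "rev_dart d \<in> \<Union>B" using e(1) by blast
  moreover have "tail (rev_dart d) = head d" "head (rev_dart d) = tail d" by (auto simp: dart_defs)
  ultimately show ?case using Cons by (simp add: walk_append)
qed auto

lemma gain_simps: "gain [] = 0" "gain (d # p) = dart_gain d + gain p"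
  "gain (p @ q) = gain p + gain q" "gain (rev (map rev_dart p)) = - gain p"
proof -
  show "gain (rev (map rev_dart p)) = - gain p"
    by (induction p) (auto simp: gain_def dart_defs)
qed (auto simp: gain_def)

lemma not_distinct_map_decomp:
  assumes "\<not> distinct (map f p)"
  shows "\<exists>xs a ys b zs. p = xs @ a # ys @ b # zs \<and> f a = f b"
  using assms
proof (induction p)
  case (Cons d p)
  show ?case
  proof (cases "distinct (map f p)")
    case True
    then obtain b where "b \<in> set p" "f d = f b" using Cons.prems by auto
    moreover then obtain ys zs where "p = ys @ b # zs" by (meson split_list)
    ultimately have "d # p = [] @ d # ys @ b # zs \<and> f d = f b" by simp
    then show ?thesis by blast
  next
    case False
    then obtain xs a ys b zs where "p = xs @ a # ys @ b # zs" "f a = f b" using Cons.IH by blast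
    then have "d # p = (d # xs) @ a # ys @ b # zs \<and> f a = f b" by simp
    then show ?thesis by blast
  qed
qed simp

lemma closed_walk_gain:
  assumes "balanced B" "walk B u p u"
  shows "gain p = 0"
  using assms(2)
proof (induction "length p" arbitrary: u p rule: less_induct)
  case less
  consider "p = []" | "p \<noteq> []" "\<not> distinct (map tail p)" |
    "p \<noteq> []" "distinct (map tail p)" "\<not> distinct (map dart_edge p)" |
    "p \<noteq> []" "distinct (map tail p)" "distinct (map dart_edge p)" by blast
  then show ?case
  proof cases
    case 1 then show ?thesis by (simp add: gain_simps)
  next
    case 2
    then obtain xs a b ys zs where p: "p = xs @ a # ys @ b # zs" "tail a = tail b"
      using not_distinct_map_decomp[OF 2(2)] by blast
    have w: "walk B (tail b) (a # ys) (tail b)" "walk B u (xs @ b # zs) u"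
      using less.prems p by (auto simp: walk_append)
    have "gain (a # ys) = 0" using less.hyps[OF _ w(1)] p by simp
    moreover have "gain (xs @ b # zs) = 0" using less.hyps[OF _ w(2)] p by simp
    ultimately show ?thesis using p by (simp add: gain_simps)
  next
    case 3
    then obtain xs a b ys zs where p: "p = xs @ a # ys @ b # zs" "dart_edge a = dart_edge b"
      using not_distinct_map_decomp[OF 3(3)] by blast
    have "tail a \<noteq> tail b" using 3 p by auto
    then have ab: "b = rev_dart a" using p(2) by (cases a; cases b) (auto simp: dart_defs doubleton_eq_iff)
    have ys: "ys = []" using less.prems p ab 3
      by (cases ys) (auto simp: walk_append dart_defs)
    have zs: "zs = []" using less.prems p ab 3 ys
      by (cases zs) (auto simp: walk_append dart_defs)
    have xs: "xs = []" using less.prems p ab 3 ys zs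
      by (cases xs) (auto simp: walk_append dart_defs)
    show ?thesis using p ab xs ys zs by (simp add: gain_simps dart_defs)
  next
    case 4
    have "tail (hd p) = u" using 4 less.prems by (cases p) auto
    then show ?thesis using assms(1) 4 less.prems by (auto simp: balanced_def is_circle_def)
  qed
qed

text \<open>
  Top vertices exist, so a choice of one in each component of each balanced edge set is possible.
\<close>
lemma top_vertex_exists:
  fixes B :: "'n::finite gain_edge set"
  assumes B: "B \<subseteq> range dart_edge" "balanced B" and C: "C \<in> component_vertex_sets B"
  shows "\<exists>t. top_vertex B C t"
proof -
  obtain r where Cr: "C = {v. \<exists>p. is_path B r p v}"
    using C by (auto simp: component_vertex_sets_def quotient_def)
  define P where "P v = (SOME p. is_path B r p v)" for v
  have P: "is_path B r (P v) v" if "v \<in> C" for v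
    using that unfolding P_def Cr by (auto intro: someI)
  have "r \<in> C" by (auto simp: Cr is_path_def intro: exI[of _ "[]"])
  moreover have "finite C" by simp
  ultimately have "Max ((\<lambda>v. gain (P v)) ` C) \<in> (\<lambda>v. gain (P v)) ` C" by (intro Max_in) auto
  then obtain t where "t \<in> C" "gain (P t) = Max ((\<lambda>v. gain (P v)) ` C)" by auto
  then have t: "t \<in> C" "\<And>v. v \<in> C \<Longrightarrow> gain (P v) \<le> gain (P t)" by auto
  have "\<not> gain p < 0" if v: "v \<in> C" "is_path B v p t" for v p
  proof -
    have "walk B r (P v @ p @ rev (map rev_dart (P t))) r"
      using P[OF v(1)] P[OF t(1)] v(2) walk_rev[OF B(1)]
      unfolding is_path_def walk_append by blast
    from closed_walk_gain[OF B(2) this] show ?thesis using t(2)[OF v(1)] by (simp add: gain_simps)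
  qed
  then show ?thesis using t(1) by (auto simp: top_vertex_def)
qed

lemma gain_graph_edges_subset: "gain_graph_edges \<A> \<subseteq> range dart_edge"
  by (auto simp: gain_graph_edges_def)

end

theory Submission
  imports Defs
begin

text \<open>
  Call an integer labelling of the vertices a solution of \<open>B\<close> if it lies on every hyperplane
  belonging to an edge of \<open>B\<close>. By inclusion-exclusion the left-hand side is the sum over all
  \<open>B \<subseteq> E\<close> of \<open>(-1)\<close> to the \<open>|B|\<close> times the number of solutions of \<open>B\<close> in the box. The labels
  of a solution differ along a walk by the gain of the walk. Hence an unbalanced \<open>B\<close> has no
  solution, and a solution of a balanced \<open>B\<close> is given by a free choice of its value at one vertex
  \<open>t\<close> of each component; it lies in the box iff, for each vertex \<open>i\<close> of the component, the value
  at \<open>t\<close> lies in \<open>L i\<close> translated by the gain from \<open>i\<close> to \<open>t\<close>.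
\<close>

section \<open>Solutions of an edge set and gains along walks\<close>

text \<open>The condition ranges over darts so that it passes directly to walks; two mutually
  reverse darts impose the same equation.\<close>

definition satisfies :: "('v \<Rightarrow> int) \<Rightarrow> 'v gain_edge set \<Rightarrow> bool" where
  "satisfies y B \<longleftrightarrow> (\<forall>d\<in>\<Union>B. y (head d) = y (tail d) + dart_gain d)"

lemma satisfies_walk:
  assumes "satisfies y B" "walk B v p w"
  shows "y w = y v + gain p"
  using assms(2)
proof (induction p arbitrary: v)
  case (Cons d p)
  then show ?case
    using assms(1) unfolding satisfies_def by (fastforce simp: gain_simps)
qed (simp add: gain_simps)

text \<open>A circle returns to its first vertex, whose label is unchanged, so its gain is 0.
  Contrapositively, an unbalanced edge set contributes nothing to the inclusion-exclusion
  sum.\<close>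

lemma satisfies_imp_balanced:
  assumes "satisfies y B"
  shows "balanced B"
  unfolding balanced_def is_circle_def using satisfies_walk[OF assms] by fastforce

lemma satisfies_dart_edge:
  "satisfies y {dart_edge (i, a, j)} \<longleftrightarrow> y j = y i + a"
  by (auto simp: satisfies_def dart_defs)

section \<open>Walks, paths and connectivity\<close>

text \<open>Paths cannot be freely concatenated, so connectivity and gains are handled through
  walks. In the induction, a path from \<open>head d\<close> that already visits \<open>v\<close> is
  cut at that visit; otherwise \<open>d\<close> is put in front of it.\<close>

lemma walk_imp_path:
  assumes "walk B v p w"
  shows "\<exists>q. is_path B v q w"
  using assms
proof (induction p arbitrary: v)
  case Nil
  then have "is_path B v [] w" by (simp add: is_path_def)
  then show ?case by blast
next
  case (Cons d p)
  then obtain q where q: "is_path B (head d) q w" by auto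
  consider "v = head d" | "v \<in> head ` set q" | "v \<notin> set (head d # map head q)" by auto
  then show ?case
  proof cases
    case 1
    with q show ?thesis by blast
  next
    case 2
    then obtain c q1 q2 where "q = q1 @ c # q2" "head c = v" by (auto dest: split_list)
    with q have "is_path B v q2 w" by (auto simp: is_path_def walk_append)
    then show ?thesis by blast
  next
    case 3
    with q Cons.prems have "is_path B v (d # q) w" by (auto simp: is_path_def)
    then show ?thesis by blast
  qed
qed

text \<open>One walk followed by the reverse of another with the same ends is closed, so balance
  makes their gains equal. This uniqueness also justifies the definite description in
  \<open>path_gain\<close>.\<close>

lemma path_gain_eq_gain:
  assumes B: "B \<subseteq> range dart_edge" "balanced B" and p: "walk B v p w"
  shows "path_gain B v w = gain p"
proof -
  have eq: "gain q = gain p" if "walk B v q w" for q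
  proof -
    have "walk B v (q @ rev (map rev_dart p)) v"
      using that walk_rev[OF B(1) p] by (auto simp: walk_append)
    from closed_walk_gain[OF B(2) this] show ?thesis by (simp add: gain_simps)
  qed
  obtain q where "is_path B v q w" using walk_imp_path[OF p] by blast
  then show ?thesis
    unfolding path_gain_def using eq by (intro the_equality) (auto simp: is_path_def)
qed

text \<open>The relation whose classes are the members of
  \<open>component_vertex_sets B\<close>.\<close>

definition connected_rel :: "'v gain_edge set \<Rightarrow> 'v rel" where
  "connected_rel B = {(v, w). \<exists>p. is_path B v p w}"

lemma connected_rel_iff_walk: "(v, w) \<in> connected_rel B \<longleftrightarrow> (\<exists>p. walk B v p w)"
  using walk_imp_path by (auto simp: connected_rel_def is_path_def)

lemma equiv_connected_rel:
  assumes "B \<subseteq> range dart_edge"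
  shows "equiv UNIV (connected_rel B)"
proof (rule equivI)
  show "refl (connected_rel B)"
    unfolding refl_on_def connected_rel_iff_walk by (auto intro: exI[of _ "[]"])
  show "sym (connected_rel B)"
    unfolding sym_def connected_rel_iff_walk using walk_rev[OF assms] by blast
  show "trans (connected_rel B)"
    unfolding trans_def connected_rel_iff_walk by (blast intro: walk_append[THEN iffD2])
qed auto

section \<open>Counting the solutions of a balanced edge set\<close>

lemma card_satisfies_eq_prod:
  fixes B :: "'v::finite gain_edge set" and L :: "'v \<Rightarrow> int set"
  assumes B: "B \<subseteq> range dart_edge" "balanced B"
    and t: "\<And>C. C \<in> component_vertex_sets B \<Longrightarrow> t C \<in> C"
  shows "card {y. (\<forall>i. y i \<in> L i) \<and> satisfies y B} =
    (\<Prod>C\<in>component_vertex_sets B. card (\<Inter>i\<in>C. (\<lambda>x. x + path_gain B i (t C)) ` L i))"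
proof -
  define K where "K = component_vertex_sets B"
  \<comment> \<open>The values allowed at \<open>t C\<close>: \<open>c \<in> Z C\<close> iff
    \<open>c - path_gain B i (t C) \<in> L i\<close> for every \<open>i \<in> C\<close>.\<close>
  define Z where "Z C = (\<Inter>i\<in>C. (\<lambda>x. x + path_gain B i (t C)) ` L i)" for C
  define comp where "comp i = connected_rel B `` {i}" for i
  note equiv = equiv_connected_rel[OF B(1)]
  have K_eq: "K = range comp"
    by (auto simp: K_def component_vertex_sets_def connected_rel_def comp_def quotient_def)
  have comp_self: "i \<in> comp i" for i
    unfolding comp_def using equiv_class_self[OF equiv] by simp
  have comp_eq: "comp i = C" if "C \<in> K" "i \<in> C" for i C
    using that equiv_class_eq[OF equiv] unfolding K_eq comp_def by blast
  have walk_t: "\<exists>p. walk B i p (t C)" if "C \<in> K" "i \<in> C" for i C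
  proof -
    have "t C \<in> comp i" using comp_eq[OF that] t that(1) by (simp add: K_def)
    then show ?thesis unfolding comp_def using connected_rel_iff_walk[of i "t C" B] by blast
  qed
  have value_t: "y (t C) = y i + path_gain B i (t C)"
    if "satisfies y B" "C \<in> K" "i \<in> C" for y i C
    using walk_t[OF that(2,3)] satisfies_walk[OF that(1)] path_gain_eq_gain[OF B] by metis
  \<comment> \<open>A dart stays within one component, and prefixing it to a walk from its head to
    the base vertex gives such a walk from its tail. The resulting equation shows that the labelling
    rebuilt from base values is a solution.\<close>
  have step: "comp (head d) = comp (tail d) \<and>
      path_gain B (tail d) (t (comp (tail d))) =
      dart_gain d + path_gain B (head d) (t (comp (head d)))" if d: "d \<in> \<Union>B" for d
  proof -
    have "walk B (tail d) [d] (head d)" using d by simp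
    then have "(tail d, head d) \<in> connected_rel B"
      unfolding connected_rel_iff_walk by (rule exI)
    then have c: "comp (head d) = comp (tail d)"
      unfolding comp_def by (rule equiv_class_eq[OF equiv, symmetric])
    obtain p where p: "walk B (head d) p (t (comp (head d)))"
      using walk_t[of "comp (head d)" "head d"] comp_self by (auto simp: K_eq)
    then have "walk B (tail d) (d # p) (t (comp (head d)))" using d by simp
    from path_gain_eq_gain[OF B this] path_gain_eq_gain[OF B p] c show ?thesis
      by (simp add: gain_simps)
  qed
  \<comment> \<open>The values are restricted to \<open>K\<close> because members of
    \<open>PiE K Z\<close> are \<open>undefined\<close> off \<open>K\<close>.\<close>
  have "bij_betw (\<lambda>y. \<lambda>C\<in>K. y (t C)) {y. (\<forall>i. y i \<in> L i) \<and> satisfies y B} (PiE K Z)"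
  \<comment> \<open>Solving \<open>value_t\<close> for \<open>y i\<close> forces this
    inverse.\<close>
  proof (rule bij_betw_byWitness[where
        f' = "\<lambda>z i. z (comp i) - path_gain B i (t (comp i))"])
    show "\<forall>y\<in>{y. (\<forall>i. y i \<in> L i) \<and> satisfies y B}.
        (\<lambda>i. (\<lambda>C\<in>K. y (t C)) (comp i) - path_gain B i (t (comp i))) = y"
    proof (intro ballI ext)
      fix y i assume "y \<in> {y. (\<forall>i. y i \<in> L i) \<and> satisfies y B}"
      then show "(\<lambda>C\<in>K. y (t C)) (comp i) - path_gain B i (t (comp i)) = y i"
        using value_t[of y "comp i" i] comp_self by (simp add: K_eq)
    qed
    show "\<forall>z\<in>PiE K Z. (\<lambda>C\<in>K. z (comp (t C)) - path_gain B (t C) (t (comp (t C)))) = z"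
    proof
      fix z assume z: "z \<in> PiE K Z"
      \<comment> \<open>The component of \<open>t C\<close> is \<open>C\<close> itself, and the
        empty walk shows that the gain from \<open>t C\<close> to itself is 0.\<close>
      have "z (comp (t C)) - path_gain B (t C) (t (comp (t C))) = z C" if "C \<in> K" for C
        using comp_eq[OF that] t[of C] that path_gain_eq_gain[OF B, of "t C" "[]" "t C"]
        by (simp add: K_def gain_simps)
      then show "(\<lambda>C\<in>K. z (comp (t C)) - path_gain B (t C) (t (comp (t C)))) = z"
        using z by (intro ext) (auto simp: restrict_def PiE_def extensional_def)
    qed
    show "(\<lambda>y. \<lambda>C\<in>K. y (t C)) ` {y. (\<forall>i. y i \<in> L i) \<and> satisfies y B} \<subseteq> PiE K Z"
    proof (intro image_subsetI restrict_PiE_iff[THEN iffD2] ballI)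
      fix y C assume y: "y \<in> {y. (\<forall>i. y i \<in> L i) \<and> satisfies y B}" and C: "C \<in> K"
      have "y (t C) \<in> (\<lambda>x. x + path_gain B i (t C)) ` L i" if "i \<in> C" for i
        using value_t[of y C i] that y C by simp
      then show "y (t C) \<in> Z C" by (simp add: Z_def)
    qed
    show "(\<lambda>z i. z (comp i) - path_gain B i (t (comp i))) ` PiE K Z
        \<subseteq> {y. (\<forall>i. y i \<in> L i) \<and> satisfies y B}"
    proof clarify
      fix z assume z: "z \<in> PiE K Z"
      have "z (comp i) - path_gain B i (t (comp i)) \<in> L i" for i
      proof -
        have "z (comp i) \<in> Z (comp i)" using z by (auto simp: K_eq)
        then show ?thesis using comp_self[of i] by (auto simp: Z_def)
      qed
      moreover have "satisfies (\<lambda>i. z (comp i) - path_gain B i (t (comp i))) B"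
        unfolding satisfies_def using step by fastforce
      ultimately show "(\<forall>i. z (comp i) - path_gain B i (t (comp i)) \<in> L i) \<and>
          satisfies (\<lambda>i. z (comp i) - path_gain B i (t (comp i))) B" by blast
    qed
  qed
  then have "card {y. (\<forall>i. y i \<in> L i) \<and> satisfies y B} = card (PiE K Z)"
    by (rule bij_betw_same_card)
  also have "\<dots> = (\<Prod>C\<in>K. card (Z C))" by (simp add: card_PiE)
  finally show ?thesis by (simp add: K_def Z_def)
qed

section \<open>Inclusion-exclusion\<close>

text \<open>Subsets with and without a fixed element \<open>a\<close> pair off with opposite
  signs.\<close>

lemma sum_Pow_minus_one_power_card:
  assumes "finite A"
  shows "(\<Sum>B\<in>Pow A. (- 1) ^ card B) = (if A = {} then 1 else 0 :: int)"
  using assms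
proof (induction A rule: finite_induct)
  case (insert a A)
  have "(\<Sum>B\<in>Pow (insert a A). (- 1) ^ card B :: int) =
      (\<Sum>B\<in>Pow A. (- 1) ^ card B) + (\<Sum>B\<in>insert a ` Pow A. (- 1) ^ card B)"
    unfolding Pow_insert using insert by (intro sum.union_disjoint) auto
  also have "(\<Sum>B\<in>insert a ` Pow A. (- 1) ^ card B :: int) =
      (\<Sum>B\<in>Pow A. (- 1) ^ card (insert a B))"
    using insert by (subst sum.reindex) (auto simp: inj_on_def)
  also have "\<dots> = (\<Sum>B\<in>Pow A. - ((- 1) ^ card B))"
  proof (rule sum.cong[OF refl])
    fix B assume "B \<in> Pow A"
    then have "finite B" "a \<notin> B" using insert finite_subset by auto
    then show "(- 1) ^ card (insert a B) = - ((- 1) ^ card B :: int)" by simp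
  qed
  finally show ?case by (simp add: sum_negf)
qed simp

text \<open>Each \<open>y\<close> is weighted by the alternating sum over the subsets of
  \<open>{e \<in> E. P y e}\<close>, which is 1 if that set is empty and 0 otherwise; then the two
  sums are exchanged.\<close>

lemma card_avoiding_eq_sum:
  assumes "finite Y" "finite E"
  shows "int (card {y \<in> Y. \<forall>e\<in>E. \<not> P y e}) =
    (\<Sum>B\<in>Pow E. (- 1) ^ card B * int (card {y \<in> Y. \<forall>e\<in>B. P y e}))"
proof -
  have "int (card {y \<in> Y. \<forall>e\<in>E. \<not> P y e}) = (\<Sum>y\<in>Y. if {e \<in> E. P y e} = {} then 1 else 0)"
    using assms(1) by (simp add: sum.inter_filter[symmetric] Ball_def)
  also have "\<dots> = (\<Sum>y\<in>Y. \<Sum>B\<in>Pow {e \<in> E. P y e}. (- 1) ^ card B)"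
    using assms(2) by (simp add: sum_Pow_minus_one_power_card)
  also have "\<dots> = (\<Sum>y\<in>Y. \<Sum>B\<in>Pow E. if \<forall>e\<in>B. P y e then (- 1) ^ card B else 0)"
  proof (rule sum.cong[OF refl])
    fix y
    have "Pow {e \<in> E. P y e} = {B \<in> Pow E. \<forall>e\<in>B. P y e}" by auto
    then show "(\<Sum>B\<in>Pow {e \<in> E. P y e}. (- 1) ^ card B) =
        (\<Sum>B\<in>Pow E. if \<forall>e\<in>B. P y e then (- 1) ^ card B else (0::int))"
      using assms(2) by (simp add: sum.inter_filter[symmetric])
  qed
  also have "\<dots> = (\<Sum>B\<in>Pow E. \<Sum>y\<in>Y. if \<forall>e\<in>B. P y e then (- 1) ^ card B else 0)"
    by (rule sum.swap)
  also have "\<dots> = (\<Sum>B\<in>Pow E. (- 1) ^ card B * int (card {y \<in> Y. \<forall>e\<in>B. P y e}))"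
    using assms(1) by (simp add: sum.inter_filter[symmetric] mult.commute)
  finally show ?thesis .
qed

section \<open>Finiteness of the gain graph\<close>

text \<open>For fixed \<open>i \<noteq> j\<close> distinct gains give distinct hyperplanes, so only
  finitely many gains occur, and there are finitely many pairs of vertices.\<close>

lemma finite_gain_graph_edges:
  fixes \<A> :: "(real ^ 'n::finite) set set"
  assumes "finite \<A>"
  shows "finite (gain_graph_edges \<A>)"
proof -
  have "finite {a. affinographic i j a \<in> \<A>}" if "i \<noteq> j" for i j :: 'n
  proof -
    have "inj (affinographic i j)"
    proof (rule injI)
      fix a b assume eq: "affinographic i j a = affinographic i j b"
      \<comment> \<open>Its \<open>i\<close>-th coordinate is 0 and its \<open>j\<close>-th is
        \<open>a\<close>, so it lies on \<open>affinographic i j b\<close> only for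
        \<open>b = a\<close>.\<close>
      have "(\<chi> k. if k = j then of_int a else 0) \<in> affinographic i j a"
        using that by (simp add: affinographic_def)
      then show "a = b" using that unfolding eq by (simp add: affinographic_def)
    qed
    then show ?thesis using finite_vimageI[OF assms] by (simp add: vimage_def)
  qed
  then have "finite (\<Union>i. \<Union>j\<in>- {i}. (\<lambda>a. dart_edge (i, a, j)) ` {a. affinographic i j a \<in> \<A>})"
    by auto
  then show ?thesis
  proof (rule rev_finite_subset, intro subsetI)
    fix e assume "e \<in> gain_graph_edges \<A>"
    then obtain i j a where "e = dart_edge (i, a, j)" "j \<in> - {i}" "affinographic i j a \<in> \<A>"
      by (auto simp: gain_graph_edges_def)
    then show "e \<in> (\<Union>i. \<Union>j\<in>- {i}. (\<lambda>a. dart_edge (i, a, j)) ` {a. affinographic i j a \<in> \<A>})"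
      by blast
  qed
qed

section \<open>From lattice points to labellings, and the final formula\<close>

theorem theorem5p20:
  fixes \<A> :: "(real ^ 'n::finite) set set"
    and L :: "'n \<Rightarrow> int set"
    and t :: "'n gain_edge set \<Rightarrow> 'n set \<Rightarrow> 'n"
  assumes "finite \<A>"
    and "\<And>H. H \<in> \<A> \<Longrightarrow> integral_affinographic H"
    and "\<And>i. finite (L i)"
    and "\<And>B C. B \<subseteq> gain_graph_edges \<A> \<Longrightarrow> balanced B \<Longrightarrow> C \<in> component_vertex_sets B \<Longrightarrow>
           top_vertex B C (t B C)"
  shows "int (card {x :: real ^ 'n. (\<forall>i. x $ i \<in> real_of_int ` L i) \<and> (\<forall>H\<in>\<A>. x \<notin> H)}) =
         (\<Sum>B | B \<subseteq> gain_graph_edges \<A> \<and> balanced B.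
            (- 1) ^ card B *
            (\<Prod>C\<in>component_vertex_sets B.
               int (card (\<Inter>i\<in>C. (\<lambda>x. x + path_gain B i (t B C)) ` L i))))"
proof -
  define E where "E = gain_graph_edges \<A>"
  define Y where "Y = {y. \<forall>i. y i \<in> L i}"
  define emb :: "('n \<Rightarrow> int) \<Rightarrow> real ^ 'n" where "emb y = (\<chi> i. of_int (y i))" for y
  have fin_E: "finite E" unfolding E_def using assms(1) by (rule finite_gain_graph_edges)
  have "Y = PiE UNIV L" by (auto simp: Y_def)
  then have fin_Y: "finite Y" using assms(3) by (simp add: finite_PiE)
  have emb_affinographic: "emb y \<in> affinographic i j a \<longleftrightarrow> y j = y i + a" for y i j a
    unfolding emb_def affinographic_def by (simp flip: of_int_add)
  \<comment> \<open>Each edge of \<open>E\<close> comes from a member of \<open>\<A>\<close>, and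
    since all members are integral affinographic, each of them yields an edge.\<close>
  have avoid: "(\<forall>H\<in>\<A>. emb y \<notin> H) \<longleftrightarrow> (\<forall>e\<in>E. \<not> satisfies y {e})" for y
  proof
    assume "\<forall>H\<in>\<A>. emb y \<notin> H"
    then show "\<forall>e\<in>E. \<not> satisfies y {e}"
      using emb_affinographic[of y]
      by (auto simp: E_def gain_graph_edges_def satisfies_dart_edge)
  next
    assume E: "\<forall>e\<in>E. \<not> satisfies y {e}"
    show "\<forall>H\<in>\<A>. emb y \<notin> H"
    proof
      fix H assume H: "H \<in> \<A>"
      then obtain i j a where ij: "i \<noteq> j" "H = affinographic i j a"
        using assms(2) unfolding integral_affinographic_def by blast
      then have "dart_edge (i, a, j) \<in> E"
        using H unfolding E_def gain_graph_edges_def by blast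
      then show "emb y \<notin> H" using E ij emb_affinographic satisfies_dart_edge by metis
    qed
  qed
  have "{x :: real ^ 'n. (\<forall>i. x $ i \<in> real_of_int ` L i) \<and> (\<forall>H\<in>\<A>. x \<notin> H)} =
      emb ` {y \<in> Y. \<forall>e\<in>E. \<not> satisfies y {e}}"
  proof (intro equalityI subsetI)
    fix x :: "real ^ 'n"
    assume x: "x \<in> {x. (\<forall>i. x $ i \<in> real_of_int ` L i) \<and> (\<forall>H\<in>\<A>. x \<notin> H)}"
    then have "\<forall>i. \<exists>k. k \<in> L i \<and> x $ i = of_int k" by auto
    then obtain y where y: "\<And>i. y i \<in> L i" "\<And>i. x $ i = of_int (y i)" by metis
    then have "x = emb y" by (simp add: emb_def vec_eq_iff)
    moreover from this x y have "y \<in> {y \<in> Y. \<forall>e\<in>E. \<not> satisfies y {e}}"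
      using avoid[of y] by (auto simp: Y_def)
    ultimately show "x \<in> emb ` {y \<in> Y. \<forall>e\<in>E. \<not> satisfies y {e}}" by blast
  next
    fix x assume "x \<in> emb ` {y \<in> Y. \<forall>e\<in>E. \<not> satisfies y {e}}"
    then obtain y where "x = emb y" "y \<in> Y" "\<forall>H\<in>\<A>. emb y \<notin> H" using avoid by auto
    then show "x \<in> {x. (\<forall>i. x $ i \<in> real_of_int ` L i) \<and> (\<forall>H\<in>\<A>. x \<notin> H)}"
      by (auto simp: Y_def emb_def)
  qed
  moreover have "inj emb" by (auto simp: inj_def emb_def vec_eq_iff)
  ultimately have "int (card {x :: real ^ 'n. (\<forall>i. x $ i \<in> real_of_int ` L i) \<and> (\<forall>H\<in>\<A>. x \<notin> H)}) =
      int (card {y \<in> Y. \<forall>e\<in>E. \<not> satisfies y {e}})"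
    by (simp add: card_image inj_on_subset)
  also have "\<dots> = (\<Sum>B\<in>Pow E. (- 1) ^ card B * int (card {y \<in> Y. \<forall>e\<in>B. satisfies y {e}}))"
    using fin_Y fin_E by (rule card_avoiding_eq_sum)
  \<comment> \<open>A labelling solves \<open>B\<close> iff it solves every single edge of
    \<open>B\<close>.\<close>
  also have "\<dots> = (\<Sum>B\<in>Pow E. (- 1) ^ card B * int (card {y. (\<forall>i. y i \<in> L i) \<and> satisfies y B}))"
    by (simp add: Y_def satisfies_def)
  also have "\<dots> = (\<Sum>B | B \<subseteq> E \<and> balanced B.
      (- 1) ^ card B * int (card {y. (\<forall>i. y i \<in> L i) \<and> satisfies y B}))"
  proof (intro sum.mono_neutral_right ballI)
    fix B assume "B \<in> Pow E - {B. B \<subseteq> E \<and> balanced B}"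
    then have "\<not> satisfies y B" for y using satisfies_imp_balanced by blast
    then show "(- 1) ^ card B * int (card {y. (\<forall>i. y i \<in> L i) \<and> satisfies y B}) = 0" by simp
  qed (use fin_E in auto)
  also have "\<dots> = (\<Sum>B | B \<subseteq> E \<and> balanced B. (- 1) ^ card B *
      (\<Prod>C\<in>component_vertex_sets B.
         int (card (\<Inter>i\<in>C. (\<lambda>x. x + path_gain B i (t B C)) ` L i))))"
  proof (rule sum.cong[OF refl])
    fix B assume "B \<in> {B. B \<subseteq> E \<and> balanced B}"
    then have B: "B \<subseteq> gain_graph_edges \<A>" "balanced B" by (auto simp: E_def)
    \<comment> \<open>A top vertex lies in its component, so it can serve as the base vertex at
      which a solution is read off.\<close>
    then have "t B C \<in> C" if "C \<in> component_vertex_sets B" for C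
      using assms(4)[OF B that] by (simp add: top_vertex_def)
    moreover have "B \<subseteq> range dart_edge" using B(1) gain_graph_edges_subset by blast
    ultimately show "(- 1) ^ card B * int (card {y. (\<forall>i. y i \<in> L i) \<and> satisfies y B}) =
        (- 1) ^ card B * (\<Prod>C\<in>component_vertex_sets B.
          int (card (\<Inter>i\<in>C. (\<lambda>x. x + path_gain B i (t B C)) ` L i)))"
      using card_satisfies_eq_prod[OF _ B(2), of "t B" L] by simp
  qed
  finally show ?thesis by (simp only: E_def)
qed

end
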